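(* Let $N\in\mathbb{N}$ and let $\mathrm{a}=\{\mathrm{a}_k:k\in\mathbb{Z}\}$ be a real mask supported in $\{0,\ldots,N\}$ whose normalized trigonometric symbol $a(y)=\frac12\sum_{k=0}^N\mathrm{a}_ke^{-2\pi i ky}$ satisfies $a(0)=1$. Assume that the level independent (stationary) subdivision scheme with mask $\mathrm{a}$ converges and that the integer shifts of its basic limit function $\phi=\lim_{j\to\infty}S_{\mathrm{a}}^j\delta$ are linearly independent. Then every analytic limit of this level independent subdivision scheme is a polynomial.
   Context: The level independent subdivision scheme with mask $\mathrm{a}$ is the iteration $c_{j+1}=S_{\mathrm{a}}c_j$, $j\in\mathbb{N}$, started from a sequence $c_1\in\ell(\mathbb{Z})$ (the space of all complex sequences on $\mathbb{Z}$), where $(S_{\mathrm{a}}c_j)_k=\sum_{m\in\mathbb{Z}}\mathrm{a}_{k-2m}\,c_{j,m}$, $k\in\mathbb{Z}$. It converges if for every $c_1\in\ell(\mathbb{Z})$ there is a continuous function $f$ on $\mathbb{R}$ (the limit of the scheme for the starting sequence $c_1$) such that for every compact $K\subset\mathbb{R}$, $\sup\{|c_{j,k}-f(2^{-(j-1)}k)|: k\in\mathbb{Z},\,2^{-(j-1)}k\in K\}\to0$ as $j\to\infty$. The basic limit function $\phi$ is the limit for $c_1=\delta$, where $\delta_0=1$ and $\delta_k=0$ for $k\ne0$. The limits of the scheme are the functions $\sum_{\ell\in\mathbb{Z}}c_{1,\ell}\,\phi(\cdot-\ell)$, $c_1\in\ell(\mathbb{Z})$, and $\widehat\phi(y)=\int_{\mathbb{R}}\phi(x)e^{-2\pi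 i xy}dx=\prod_{j=1}^\infty a(2^{-j}y)$. The integer shifts of $\phi$ are linearly independent if $\sum_{\ell\in\mathbb{Z}}c_\ell\,\phi(\cdot-\ell)=0$ with $(c_\ell)\in\ell(\mathbb{Z})$ implies $c_\ell=0$ for all $\ell$. An analytic function on $\mathbb{R}$ is an infinitely differentiable function having a power series expansion around each point of $\mathbb{R}$. *)

theory Defs
  imports "HOL-Analysis.Analysis" "HOL-Computational_Algebra.Polynomial"
begin

definition mask_supported :: "nat \<Rightarrow> (int \<Rightarrow> real) \<Rightarrow> bool" where
  "mask_supported N a \<longleftrightarrow> (\<forall>k. k \<notin> {0..int N} \<longrightarrow> a k = 0)"

definition symbol :: "nat \<Rightarrow> (int \<Rightarrow> real) \<Rightarrow> real \<Rightarrow> complex" where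
  "symbol N a y = 1 / 2 * (\<Sum>k=0..N. of_real (a (int k)) * exp (- 2 * of_real pi * \<i> * of_nat k * of_real y))"

(* For a finitely supported mask only finitely many summands are nonzero, so the infinite sum
   is a finite one and is defined for every sequence c. *)
definition subdivision :: "(int \<Rightarrow> real) \<Rightarrow> (int \<Rightarrow> complex) \<Rightarrow> int \<Rightarrow> complex" where
  "subdivision a c k = (\<Sum>\<^sub>\<infinity>m\<in>(UNIV :: int set). of_real (a (k - 2 * m)) * c m)"

(* The index n stands for j - 1, so that the n-th iterate is the sequence c_j of the scheme
   started from c = c_1.  The supremum is taken in ennreal: it is 0 when K contains no point
   of the grid, and infinite when the errors are unbounded. *)
definition subdivision_limit ::
    "(int \<Rightarrow> real) \<Rightarrow> (int \<Rightarrow> complex) \<Rightarrow> (real \<Rightarrow> complex) \<Rightarrow> bool" where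
  "subdivision_limit a c f \<longleftrightarrow>
     continuous_on UNIV f \<and>
     (\<forall>K. compact K \<longrightarrow>
        (\<lambda>n. SUP k\<in>{k::int. real_of_int k / 2 ^ n \<in> K}.
               ennreal (cmod ((subdivision a ^^ n) c k - f (real_of_int k / 2 ^ n))))
          \<longlonglongrightarrow> 0)"

definition subdivision_converges :: "(int \<Rightarrow> real) \<Rightarrow> bool" where
  "subdivision_converges a \<longleftrightarrow> (\<forall>c. \<exists>f. subdivision_limit a c f)"

definition delta_seq :: "int \<Rightarrow> complex" where
  "delta_seq k = (if k = 0 then 1 else 0)"

(* Used for compactly supported \<phi>, where the sum over the integers is finite at every x. *)
definition linearly_independent_shifts :: "(real \<Rightarrow> complex) \<Rightarrow> bool" where
  "linearly_independent_shifts \<phi> \<longleftrightarrow>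
     (\<forall>c :: int \<Rightarrow> complex.
        (\<forall>x. ((\<lambda>l. c l * \<phi> (x - of_int l)) has_sum 0) UNIV) \<longrightarrow> (\<forall>l. c l = 0))"

definition infinitely_differentiable :: "(real \<Rightarrow> complex) \<Rightarrow> bool" where
  "infinitely_differentiable f \<longleftrightarrow>
     (\<exists>F :: nat \<Rightarrow> real \<Rightarrow> complex. F 0 = f \<and>
        (\<forall>n x. (F n has_vector_derivative F (Suc n) x) (at x)))"

(* Analyticity on the real line of a complex-valued function; the library's analytic_on is about
   functions of a complex variable. *)
definition real_line_analytic :: "(real \<Rightarrow> complex) \<Rightarrow> bool" where
  "real_line_analytic f \<longleftrightarrow>
     infinitely_differentiable f \<and>
     (\<forall>x0. \<exists>r>0. \<exists>b :: nat \<Rightarrow> complex. \<forall>x. \<bar>x - x0\<bar> < r \<longrightarrow>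
        (\<lambda>n. b n * of_real (x - x0) ^ n) sums f x)"

end

theory Submission
  imports Defs "HOL-Complex_Analysis.Cauchy_Integral_Formula"
begin

text \<open>
  Let \<open>f\<close> be the limit of the scheme for the starting sequence \<open>c\<close>, and write \<open>S\<close> for the
  subdivision operator.  The function \<open>x \<mapsto> f (x / 2 ^ j)\<close> is the limit for \<open>S\<^sup>j c\<close>, because the
  values of \<open>S\<^sup>n (S\<^sup>j c)\<close> on the grid of width \<open>2\<^sup>-\<^sup>n\<close> are those of \<open>S\<^sup>n\<^sup>+\<^sup>j c\<close> on the grid of width
  \<open>2\<^sup>-\<^sup>(\<^sup>n\<^sup>+\<^sup>j\<^sup>)\<close>.  On the other hand the mask is finitely supported, so that on \<open>[-1, 1]\<close> a limit depends
  only on the finitely many entries of its starting sequence with index in \<open>{-(N + 1)..1}\<close>.  Hence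
  the dilates \<open>f (x / 2 ^ j)\<close>, restricted to \<open>[-1, 1]\<close>, all lie in one space of finite dimension and
  satisfy a nontrivial relation \<open>(\<Sum>j. \<alpha> j * f (x / 2 ^ j)) = 0\<close>.

  If \<open>f\<close> has the power series \<open>\<Sum>n. b n * x ^ n\<close> around \<open>0\<close>, comparing coefficients in this
  relation gives \<open>b n * q ((1 / 2) ^ n) = 0\<close> with the nonzero polynomial \<open>q = (\<Sum>j. \<alpha> j * X ^ j)\<close>.
  As \<open>q\<close> has finitely many roots, \<open>b n = 0\<close> for all large \<open>n\<close>: near \<open>0\<close> the function \<open>f\<close> agrees with
  a polynomial, and by analytic continuation it does so everywhere.
\<close>

section \<open>Homogeneous linear systems\<close>

text \<open>Gaussian elimination: an equation with a nonzero coefficient is used to eliminate the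
  unknown that belongs to it.\<close>

lemma underdetermined_system_nontrivial_solution:
  fixes v :: "'j \<Rightarrow> 'i \<Rightarrow> 'k::field"
  assumes "finite I" "finite J" "card I < card J"
  shows "\<exists>\<alpha>. (\<exists>j\<in>J. \<alpha> j \<noteq> 0) \<and> (\<forall>i\<in>I. (\<Sum>j\<in>J. \<alpha> j * v j i) = 0)"
  using assms
proof (induction I arbitrary: J v rule: finite_induct)
  case empty
  then obtain j where "j \<in> J"
    by (metis card_gt_0_iff card.empty ex_in_conv)
  then show ?case
    by (intro exI[of _ "\<lambda>_. 1"]) auto
next
  case (insert i I)
  show ?case
  proof (cases "\<forall>j\<in>J. v j i = 0")
    case True
    have "card I < card J"
      using insert.hyps insert.prems by simp
    from insert.IH[OF \<open>finite J\<close> this, of v] obtain \<alpha> where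
      "\<exists>j\<in>J. \<alpha> j \<noteq> 0" "\<forall>i\<in>I. (\<Sum>j\<in>J. \<alpha> j * v j i) = 0"
      by blast
    with True show ?thesis
      by (intro exI[of _ \<alpha>]) simp
  next
    case False
    then obtain l where l: "l \<in> J" "v l i \<noteq> 0"
      by blast
    define w where "w j i' = v j i' - v j i / v l i * v l i'" for j i'
    have "card I < card (J - {l})"
      using insert.hyps insert.prems l by simp
    from insert.IH[OF _ this, of w] obtain \<beta> where
      \<beta>: "\<exists>j\<in>J - {l}. \<beta> j \<noteq> 0" "\<And>i'. i' \<in> I \<Longrightarrow> (\<Sum>j\<in>J - {l}. \<beta> j * w j i') = 0"
      using insert.prems by auto
    define \<alpha> where "\<alpha> j = (if j = l then - (\<Sum>j\<in>J - {l}. \<beta> j * v j i / v l i) else \<beta> j)" for j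
    have split: "(\<Sum>j\<in>J. \<alpha> j * v j i') = (\<Sum>j\<in>J - {l}. \<beta> j * w j i')" for i'
    proof -
      have "(\<Sum>j\<in>J. \<alpha> j * v j i') = \<alpha> l * v l i' + (\<Sum>j\<in>J - {l}. \<alpha> j * v j i')"
        using insert.prems l by (simp add: sum.remove)
      also have "(\<Sum>j\<in>J - {l}. \<alpha> j * v j i') = (\<Sum>j\<in>J - {l}. \<beta> j * v j i')"
        by (rule sum.cong) (auto simp: \<alpha>_def)
      also have "\<alpha> l * v l i' = - (\<Sum>j\<in>J - {l}. \<beta> j * v j i / v l i * v l i')"
        by (simp add: \<alpha>_def sum_distrib_right)
      finally show ?thesis
        by (simp add: w_def sum_subtractf algebra_simps)
    qed
    have "w j i = 0" for j
      using l by (simp add: w_def)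
    then have "\<forall>i'\<in>insert i I. (\<Sum>j\<in>J. \<alpha> j * v j i') = 0"
      using \<beta> by (simp add: split)
    moreover have "\<exists>j\<in>J. \<alpha> j \<noteq> 0"
      using \<beta>(1) by (auto simp: \<alpha>_def)
    ultimately show ?thesis
      by blast
  qed
qed

section \<open>The subdivision operator of a finitely supported mask\<close>

lemma subdivision_eq_sum:
  assumes "mask_supported N a"
  shows "subdivision a c k = (\<Sum>m\<in>{(k - int N) div 2..k div 2}. of_real (a (k - 2 * m)) * c m)"
proof -
  have "of_real (a (k - 2 * m)) * c m = 0" if "m \<notin> {(k - int N) div 2..k div 2}" for m
  proof -
    have "k - 2 * m \<notin> {0..int N}"
      using that by (auto; presburger)
    then show ?thesis
      using assms by (simp add: mask_supported_def)
  qed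
  then have "subdivision a c k =
      (\<Sum>\<^sub>\<infinity>m\<in>{(k - int N) div 2..k div 2}. of_real (a (k - 2 * m)) * c m)"
    unfolding subdivision_def by (intro infsum_cong_neutral) auto
  then show ?thesis
    by simp
qed

lemma subdivision_linear_combination:
  assumes "mask_supported N a"
  shows "subdivision a (\<lambda>m. \<Sum>j\<in>J. \<alpha> j * c j m) = (\<lambda>k. \<Sum>j\<in>J. \<alpha> j * subdivision a (c j) k)"
proof
  fix k
  show "subdivision a (\<lambda>m. \<Sum>j\<in>J. \<alpha> j * c j m) k = (\<Sum>j\<in>J. \<alpha> j * subdivision a (c j) k)"
    unfolding subdivision_eq_sum[OF assms] sum_distrib_left
    by (subst sum.swap) (simp add: mult_ac)
qed

lemma subdivision_iterate_linear_combination: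
  assumes "mask_supported N a"
  shows "(subdivision a ^^ n) (\<lambda>m. \<Sum>j\<in>J. \<alpha> j * c j m) =
    (\<lambda>k. \<Sum>j\<in>J. \<alpha> j * (subdivision a ^^ n) (c j) k)"
  by (induction n) (simp_all add: subdivision_linear_combination[OF assms])

text \<open>Entry \<open>k\<close> of the refined sequence only sees the indices between \<open>(k - N) / 2\<close> and \<open>k / 2\<close>.
  The left margin is split into a part \<open>A\<close>, which doubles, and the part \<open>N\<close>, which is what one step
  with a mask of length \<open>N\<close> leaves invariant: \<open>2 (A + N) - N = 2 A + N\<close>.\<close>

lemma subdivision_iterate_local:
  assumes "mask_supported N a"
    and "\<And>m. m \<in> {- (A + int N)..B} \<Longrightarrow> c m = 0"
    and "k \<in> {- (2 ^ n * A + int N)..2 ^ n * B}"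
  shows "(subdivision a ^^ n) c k = 0"
  using assms(3)
proof (induction n arbitrary: k)
  case 0
  then show ?case
    using assms(2) by simp
next
  case (Suc n)
  have "(subdivision a ^^ n) c m = 0" if "m \<in> {(k - int N) div 2..k div 2}" for m
  proof (rule Suc.IH)
    define A' B' where "A' = 2 ^ n * A" and "B' = 2 ^ n * B"
    have "k \<in> {- (2 * A' + int N)..2 * B'}"
      using Suc.prems by (simp add: A'_def B'_def)
    with that have "m \<in> {- (A' + int N)..B'}"
      by (auto; presburger)
    then show "m \<in> {- (2 ^ n * A + int N)..2 ^ n * B}"
      by (simp add: A'_def B'_def)
  qed
  then show ?case
    unfolding funpow.simps o_apply by (subst subdivision_eq_sum[OF assms(1)]) simp
qed

section \<open>Limits and their dilates\<close>

text \<open>Because the convergence is uniform on compact sets, \<open>f x\<close> can be read off along grid points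
  that move towards \<open>x\<close>.  With rounding down, the grid point for the dilate \<open>x / 2 ^ j\<close> at level
  \<open>n + j\<close> has the same index as the one for \<open>x\<close> at level \<open>n\<close>.\<close>

lemma subdivision_limit_at_floor:
  assumes "subdivision_limit a c f"
  shows "(\<lambda>n. (subdivision a ^^ n) c \<lfloor>x * 2 ^ n\<rfloor>) \<longlonglongrightarrow> f x"
proof -
  define k where "k n = \<lfloor>x * 2 ^ n\<rfloor>" for n :: nat
  define t where "t n = real_of_int (k n) / 2 ^ n" for n
  define K where "K = {x - 1..x}"
  have bounds: "x - (1 / 2) ^ n \<le> t n" "t n \<le> x" for n
  proof -
    have "x * 2 ^ n - 1 \<le> real_of_int (k n)" "real_of_int (k n) \<le> x * 2 ^ n"
      unfolding k_def by linarith+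
    then have "(x * 2 ^ n - 1) / 2 ^ n \<le> t n" "t n \<le> x * 2 ^ n / 2 ^ n"
      unfolding t_def by (simp_all only: divide_right_mono zero_le_power zero_le_numeral)
    then show "x - (1 / 2) ^ n \<le> t n" "t n \<le> x"
      by (simp_all add: diff_divide_distrib power_one_over)
  qed
  have tK: "t n \<in> K" for n
  proof -
    have "(1 / 2 :: real) ^ n \<le> 1"
      by (simp add: power_le_one)
    with bounds[of n] show ?thesis
      by (simp add: K_def)
  qed
  have "(\<lambda>n. x - (1 / 2 :: real) ^ n) \<longlonglongrightarrow> x - 0"
    by (intro tendsto_intros LIMSEQ_power_zero) simp
  then have "t \<longlonglongrightarrow> x"
    using bounds by (intro tendsto_sandwich[of "\<lambda>n. x - (1 / 2) ^ n" t sequentially "\<lambda>_. x"]) auto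
  moreover have "isCont f x"
    using assms by (simp add: subdivision_limit_def continuous_on_eq_continuous_at)
  ultimately have ft: "(\<lambda>n. f (t n)) \<longlonglongrightarrow> f x"
    by (rule isCont_tendsto_compose[rotated])
  define err where "err n = (subdivision a ^^ n) c (k n) - f (t n)" for n
  have "(\<lambda>n. SUP k\<in>{k::int. real_of_int k / 2 ^ n \<in> K}.
      ennreal (cmod ((subdivision a ^^ n) c k - f (real_of_int k / 2 ^ n)))) \<longlonglongrightarrow> 0"
    using assms compact_Icc[of "x - 1" x] unfolding subdivision_limit_def K_def by blast
  then have "(\<lambda>n. ennreal (cmod (err n))) \<longlonglongrightarrow> 0"
  proof (rule tendsto_sandwich[OF _ _ tendsto_const, rotated 2])
    show "\<forall>\<^sub>F n in sequentially. ennreal (cmod (err n)) \<le>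
      (SUP k\<in>{k::int. real_of_int k / 2 ^ n \<in> K}.
        ennreal (cmod ((subdivision a ^^ n) c k - f (real_of_int k / 2 ^ n))))"
      using tK by (intro always_eventually allI) (auto simp: err_def t_def intro!: SUP_upper2)
  qed simp
  then have "err \<longlonglongrightarrow> 0"
    by (simp add: ennreal_tendsto_0_iff tendsto_norm_zero_iff)
  from tendsto_add[OF this ft] show ?thesis
    by (simp add: err_def k_def)
qed

text \<open>The finer grid of \<open>S\<^sup>n\<^sup>+\<^sup>j c\<close> absorbs the dilation: \<open>f (x / 2 ^ j)\<close> is the limit for the starting
  sequence \<open>S\<^sup>j c\<close>.\<close>

lemma subdivision_limit_dilate_at_floor:
  assumes "subdivision_limit a c f"
  shows "(\<lambda>n. (subdivision a ^^ n) ((subdivision a ^^ j) c) \<lfloor>x * 2 ^ n\<rfloor>) \<longlonglongrightarrow> f (x / 2 ^ j)"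
  using LIMSEQ_ignore_initial_segment[OF subdivision_limit_at_floor[OF assms, of "x / 2 ^ j"], of j]
  by (simp add: funpow_add power_add)

text \<open>On the finite window of indices that is visible from \<open>[-1, 1]\<close>, the sequences \<open>S\<^sup>j c\<close> are
  linearly dependent as soon as there are more of them than indices.  A combination that vanishes on
  the window has iterates that vanish at all grid points of \<open>[-1, 1]\<close>, so its limit is zero there.\<close>

lemma limit_dilates_dependent:
  assumes mask: "mask_supported N a" and lim: "subdivision_limit a c f"
  obtains J :: nat and \<alpha> :: "nat \<Rightarrow> complex"
  where "\<exists>j\<le>J. \<alpha> j \<noteq> 0"
    and "\<And>x. \<bar>x\<bar> \<le> 1 \<Longrightarrow> (\<Sum>j\<le>J. \<alpha> j * f (x / 2 ^ j)) = 0"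
proof -
  let ?S = "subdivision a"
  define I where "I = {- (1 + int N)..1}"
  have "finite I"
    by (simp add: I_def)
  from underdetermined_system_nontrivial_solution[OF this, of "{..card I}" "\<lambda>j. (?S ^^ j) c"]
  obtain \<alpha> where \<alpha>: "\<exists>j\<le>card I. \<alpha> j \<noteq> 0" "\<And>m. m \<in> I \<Longrightarrow> (\<Sum>j\<le>card I. \<alpha> j * (?S ^^ j) c m) = 0"
    by auto
  have "(\<Sum>j\<le>card I. \<alpha> j * f (x / 2 ^ j)) = 0" if "\<bar>x\<bar> \<le> 1" for x
  proof -
    have vanish: "(\<Sum>j\<le>card I. \<alpha> j * (?S ^^ n) ((?S ^^ j) c) \<lfloor>x * 2 ^ n\<rfloor>) = 0" for n
    proof -
      have "- (2 ^ n) \<le> x * 2 ^ n" "x * 2 ^ n \<le> 2 ^ n"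
        using that mult_right_mono[of "-1" x "2 ^ n"] mult_right_mono[of x 1 "2 ^ n"] by auto
      then have "- (2 ^ n) \<le> \<lfloor>x * 2 ^ n\<rfloor>" "\<lfloor>x * 2 ^ n\<rfloor> \<le> 2 ^ n"
        using floor_mono[of "x * 2 ^ n" "2 ^ n"] by (simp_all add: le_floor_iff)
      then have "\<lfloor>x * 2 ^ n\<rfloor> \<in> {- (2 ^ n * 1 + int N)..2 ^ n * 1}"
        by simp
      from subdivision_iterate_local[OF mask _ this, of "\<lambda>m. \<Sum>j\<le>card I. \<alpha> j * (?S ^^ j) c m"]
      show ?thesis
        using \<alpha>(2) by (simp add: I_def subdivision_iterate_linear_combination[OF mask])
    qed
    have "(\<lambda>n. \<Sum>j\<le>card I. \<alpha> j * (?S ^^ n) ((?S ^^ j) c) \<lfloor>x * 2 ^ n\<rfloor>)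
        \<longlonglongrightarrow> (\<Sum>j\<le>card I. \<alpha> j * f (x / 2 ^ j))"
      by (intro tendsto_intros subdivision_limit_dilate_at_floor lim)
    then show ?thesis
      by (simp add: vanish LIMSEQ_const_iff)
  qed
  with \<alpha>(1) show ?thesis
    by (rule that)
qed

section \<open>Power series on the real line\<close>

text \<open>Zeros of a nonzero power series are isolated.  The series converges on a disc of the complex
  plane, so the theorem on isolated zeros of complex power series applies; it concerns a zero at the
  centre, and multiplying the series by the variable makes its value there vanish.\<close>

lemma real_powser_zero_coeffs:
  fixes d :: "nat \<Rightarrow> complex"
  assumes "r > 0"
    and sums: "\<And>x. \<bar>x\<bar> < r \<Longrightarrow> (\<lambda>n. d n * of_real x ^ n) sums g x"
    and zeros: "\<exists>\<^sub>F x in at 0. g x = 0"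
  shows "d m = 0"
proof (rule ccontr)
  assume m: "d m \<noteq> 0"
  define G where "G z = (\<Sum>n. d n * z ^ n)" for z
  define d' where "d' n = (case n of 0 \<Rightarrow> 0 | Suc i \<Rightarrow> d i)" for n
  have "(\<lambda>n. d' n * z ^ n) sums (z * G z)" if z: "cmod z < r" for z
  proof -
    define s where "s = (cmod z + r) / 2"
    have s: "cmod z < s" "\<bar>s\<bar> < r"
      using z norm_ge_zero[of z] by (auto simp: s_def abs_if simp del: norm_ge_zero)
    have "summable (\<lambda>n. d n * of_real s ^ n)"
      using sums[OF s(2)] by (rule sums_summable)
    then have "summable (\<lambda>n. d n * z ^ n)"
      by (rule powser_inside) (use s in auto)
    then have "(\<lambda>n. z * (d n * z ^ n)) sums (z * G z)"
      unfolding G_def by (intro sums_mult summable_sums)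
    then have "(\<lambda>n. d' (Suc n) * z ^ Suc n) sums (z * G z - d' 0 * z ^ 0)"
      by (simp add: d'_def mult_ac)
    then show ?thesis
      by (subst (asm) sums_Suc_iff) simp
  qed
  moreover have "d' (Suc m) \<noteq> 0"
    using m by (simp add: d'_def)
  ultimately obtain s where
    s: "s > 0" "\<And>z. z \<in> cball 0 s \<Longrightarrow> z \<noteq> 0 \<Longrightarrow> z * G z \<noteq> 0"
    using powser_0_nonzero[of r 0 d' "\<lambda>z. z * G z" "Suc m"] \<open>r > 0\<close>
    by (simp add: d'_def) metis
  have "\<forall>\<^sub>F x in at 0. g x \<noteq> 0"
    unfolding eventually_at
  proof (intro exI conjI ballI impI)
    show "0 < min r s"
      using \<open>r > 0\<close> s by simp
  next
    fix x :: real assume x: "x \<noteq> 0 \<and> dist x 0 < min r s"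
    then have "g x = G (of_real x)"
      using sums[of x] by (simp add: G_def sums_iff)
    then show "g x \<noteq> 0"
      using s(2)[of "of_real x"] x by auto
  qed
  with zeros show False
    by (simp add: frequently_def)
qed

text \<open>The set of points near which \<open>f\<close> and \<open>p\<close> agree is open by construction; it is closed since
  the power series of \<open>f - p\<close> around a limit point has zeros accumulating there.\<close>

lemma real_line_analytic_eq_poly:
  assumes an: "real_line_analytic f"
    and near: "\<forall>\<^sub>F x in nhds x1. f x = poly p (of_real x)"
  shows "f x = poly p (of_real x)"
proof -
  define U where "U = {y. \<forall>\<^sub>F x in nhds y. f x = poly p (of_real x)}"
  have "open U"
  proof (subst open_subopen, intro ballI)
    fix y assume "y \<in> U"
    then obtain V where "open V" "y \<in> V" "\<And>x. x \<in> V \<Longrightarrow> f x = poly p (of_real x)"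
      by (auto simp: U_def eventually_nhds)
    then show "\<exists>V. open V \<and> y \<in> V \<and> V \<subseteq> U"
      by (intro exI[of _ V]) (auto simp: U_def intro: eventually_nhds_in_open[THEN eventually_mono])
  qed
  moreover have "closed U"
    unfolding closed_limpt
  proof (intro allI impI)
    fix y assume "y islimpt U"
    from an obtain r b where r: "r > 0"
      and sums_f: "\<And>x. \<bar>x - y\<bar> < r \<Longrightarrow> (\<lambda>n. b n * of_real (x - y) ^ n) sums f x"
      unfolding real_line_analytic_def by metis
    \<comment> \<open>the Taylor polynomial of \<open>p\<close> at \<open>y\<close>\<close>
    define q where "q = pcompose p [:of_real y, 1:]"
    define g where "g h = f (y + h) - poly p (of_real (y + h))" for h
    have sums_g: "(\<lambda>n. (b n - coeff q n) * of_real h ^ n) sums g h" if "\<bar>h\<bar> < r" for h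
    proof -
      have "(\<lambda>n. coeff q n * of_real h ^ n) sums (\<Sum>n\<le>degree q. coeff q n * of_real h ^ n)"
        by (rule sums_finite) (auto simp: coeff_eq_0)
      then have "(\<lambda>n. coeff q n * of_real h ^ n) sums poly p (of_real (y + h))"
        by (simp add: poly_altdef[symmetric] q_def poly_pcompose)
      with sums_f[of "y + h"] that show ?thesis
        unfolding g_def by (simp add: left_diff_distrib sums_diff)
    qed
    have "\<exists>\<^sub>F h in at 0. g h = 0"
    proof -
      have "\<exists>\<^sub>F x in at y. x \<in> U"
        using \<open>y islimpt U\<close> by (simp add: islimpt_conv_frequently_at)
      then have "\<exists>\<^sub>F x in at y. f x = poly p (of_real x)"
        by (rule frequently_elim1) (auto simp: U_def dest: eventually_nhds_x_imp_x)
      then show ?thesis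
        unfolding at_to_0[of y] frequently_def eventually_filtermap by (simp add: g_def add.commute)
    qed
    from real_powser_zero_coeffs[OF r sums_g this] have "g h = 0" if "\<bar>h\<bar> < r" for h
      using sums_g[OF that] by (simp add: sums_iff)
    then have "f x = poly p (of_real x)" if "dist x y < r" for x
      using that[unfolded dist_real_def] by (force simp: g_def dest: spec[of _ "x - y"])
    then show "y \<in> U"
      using r by (auto simp: U_def eventually_nhds_metric)
  qed
  moreover have "x1 \<in> U"
    using near by (simp add: U_def)
  ultimately have "U = UNIV"
    using clopen by blast
  then have "x \<in> U"
    by simp
  then show ?thesis
    by (auto simp: U_def dest: eventually_nhds_x_imp_x)
qed

section \<open>Analytic functions with dependent dilates\<close>

text \<open>A dilation relation multiplies the \<open>n\<close>-th Taylor coefficient at \<open>0\<close> by the value of a fixed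
  nonzero polynomial at \<open>(1 / 2) ^ n\<close>, and that value vanishes for finitely many \<open>n\<close> only.\<close>

lemma real_line_analytic_dilates_dependent_imp_poly:
  fixes \<alpha> :: "nat \<Rightarrow> complex"
  assumes an: "real_line_analytic f"
    and \<alpha>: "\<exists>j\<le>J. \<alpha> j \<noteq> 0"
    and rel: "\<forall>\<^sub>F x in at 0. (\<Sum>j\<le>J. \<alpha> j * f (x / 2 ^ j)) = 0"
  shows "\<exists>p :: complex poly. \<forall>x. f x = poly p (of_real x)"
proof -
  from an obtain r b where r: "r > 0"
    and "\<And>x. \<bar>x - 0\<bar> < r \<Longrightarrow> (\<lambda>n. b n * of_real (x - 0) ^ n) sums f x"
    unfolding real_line_analytic_def by metis
  then have sums_f: "\<And>x. \<bar>x\<bar> < r \<Longrightarrow> (\<lambda>n. b n * of_real x ^ n) sums f x"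
    by simp
  define q where "q = (\<Sum>j\<le>J. monom (\<alpha> j) j)"
  have poly_q: "poly q z = (\<Sum>j\<le>J. \<alpha> j * z ^ j)" for z
    by (simp add: q_def poly_sum poly_monom)
  have coeff_q: "coeff q j = \<alpha> j" if "j \<le> J" for j
    using that by (simp add: q_def coeff_sum)
  have "q \<noteq> 0"
    using \<alpha> coeff_q by force
  have "b n * poly q ((1 / 2) ^ n) = 0" for n
  proof (rule real_powser_zero_coeffs[where d = "\<lambda>n. b n * poly q ((1 / 2) ^ n)", OF r])
    fix x :: real assume x: "\<bar>x\<bar> < r"
    have "(\<lambda>n. \<alpha> j * (b n * of_real (x / 2 ^ j) ^ n)) sums (\<alpha> j * f (x / 2 ^ j))" for j
    proof (intro sums_mult sums_f)
      have "\<bar>x\<bar> / 2 ^ j \<le> \<bar>x\<bar> / 1"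
        by (intro divide_left_mono) auto
      with x show "\<bar>x / 2 ^ j\<bar> < r"
        by simp
    qed
    then have "(\<lambda>n. \<Sum>j\<le>J. \<alpha> j * (b n * of_real (x / 2 ^ j) ^ n)) sums (\<Sum>j\<le>J. \<alpha> j * f (x / 2 ^ j))"
      by (rule sums_sum)
    moreover have "(\<Sum>j\<le>J. \<alpha> j * (b n * of_real (x / 2 ^ j) ^ n)) =
        b n * poly q ((1 / 2) ^ n) * of_real x ^ n" for n
    proof -
      have "of_real (x / 2 ^ j) ^ n = ((1 / 2) ^ n) ^ j * (of_real x ^ n :: complex)" for j
        by (simp add: power_divide flip: power_mult) (simp add: mult.commute)
      then show ?thesis
        unfolding poly_q sum_distrib_left sum_distrib_right by (simp only: mult_ac)
    qed
    ultimately show "(\<lambda>n. b n * poly q ((1 / 2) ^ n) * of_real x ^ n) sums (\<Sum>j\<le>J. \<alpha> j * f (x / 2 ^ j))"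
      by simp
  next
    show "\<exists>\<^sub>F x in at 0. (\<Sum>j\<le>J. \<alpha> j * f (x / 2 ^ j)) = 0"
      by (rule eventually_frequently[OF _ rel]) simp
  qed
  then have "{n. b n \<noteq> 0} \<subseteq> (\<lambda>n. (1 / 2) ^ n) -` {z. poly q z = 0}"
    by auto
  moreover have "inj (\<lambda>n. (1 / 2 :: complex) ^ n)"
    by (rule injI, drule arg_cong[of _ _ norm]) (simp add: norm_power norm_divide power_one_over)
  ultimately have "finite {n. b n \<noteq> 0}"
    using poly_roots_finite[OF \<open>q \<noteq> 0\<close>] finite_subset finite_vimageI by metis
  define p where "p = (\<Sum>n | b n \<noteq> 0. monom (b n) n)"
  have "f x = poly p (of_real x)" if "\<bar>x\<bar> < r" for x
  proof -
    have "(\<lambda>n. b n * of_real x ^ n) sums (\<Sum>n | b n \<noteq> 0. b n * of_real x ^ n)"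
      by (rule sums_finite) (use \<open>finite {n. b n \<noteq> 0}\<close> in auto)
    with sums_f[OF that] show ?thesis
      by (simp add: p_def poly_sum poly_monom sums_iff)
  qed
  then have "\<forall>\<^sub>F x in nhds 0. f x = poly p (of_real x)"
    using r by (auto simp: eventually_nhds_metric)
  from real_line_analytic_eq_poly[OF an this] show ?thesis
    by blast
qed

section \<open>Analytic limits\<close>

theorem corollary5p3:
  fixes N :: nat and a :: "int \<Rightarrow> real" and \<phi> :: "real \<Rightarrow> complex"
  assumes "mask_supported N a"
    and "symbol N a 0 = 1"
    and "subdivision_converges a"
    and "subdivision_limit a delta_seq \<phi>"
    and "linearly_independent_shifts \<phi>"
  shows "\<forall>c f. subdivision_limit a c f \<and> real_line_analytic f \<longrightarrow>
           (\<exists>p :: complex poly. \<forall>x. f x = poly p (of_real x))"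
proof (intro allI impI, elim conjE)
  fix c f
  assume lim: "subdivision_limit a c f" and an: "real_line_analytic f"
  from limit_dilates_dependent[OF assms(1) lim] obtain J \<alpha> where
    \<alpha>: "\<exists>j\<le>J. \<alpha> j \<noteq> 0" "\<And>x. \<bar>x\<bar> \<le> 1 \<Longrightarrow> (\<Sum>j\<le>J. \<alpha> j * f (x / 2 ^ j)) = 0"
    by blast
  have "\<forall>\<^sub>F x in at 0. (\<Sum>j\<le>J. \<alpha> j * f (x / 2 ^ j)) = 0"
    unfolding eventually_at using \<alpha>(2) by (auto intro!: exI[of _ 1])
  from real_line_analytic_dilates_dependent_imp_poly[OF an \<alpha>(1) this]
  show "\<exists>p :: complex poly. \<forall>x. f x = poly p (of_real x)" .
qed

end
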